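(* If $T$ is a storage operator, then, for every successor $\underline{S}$, $T$ is an $\underline{S}$-storage operator.
   Context: Notation: $(t)u$ denotes application of $t$ to $u$, and $(t)u_1\dots u_n$ stands for $(\dots((t)u_1)\dots)u_n$; $\overline{c}$ denotes a finite sequence of terms $c_1,\dots,c_k$. $u \succ v$ means $v$ is obtained from $u$ by finitely many head-reduction steps. $(u)^0v=v$, $(u)^{n+1}v=(u)(u)^nv$. For each $n$, the Church integer is $\underline{n}=\lambda f\lambda x (f)^n x$. A closed $\lambda$-term $\underline{S}$ is a successor iff $(\underline{S})\underline{k}\simeq_\beta \underline{k+1}$ for every $k\ge 0$. A closed $\lambda$-term $T$ is a storage operator iff for every $n\ge 0$ there is a closed $\lambda$-term $\tau_n\simeq_\beta \underline{n}$ such that for every $\theta_n\simeq_\beta\underline{n}$, $(T)\theta_n f \succ (f)\tau_n$ (where $f$ is a fresh variable). $\lambda X$-terms: terms built from variables and constants $X_i$ ($i\ge 0$) by abstraction and application, together with constants $X_{n,a,b,\overline{c}}$ for every $n\in\mathbb N$ and $\lambda X$-terms $a,b,\overline{c}$ ($X_{n,a,b,\overline{c}}$ is regarded as a constant not occurring in $a,b,\overline{c}$). Given a successor $\underline{S}$, a closed $\lambda$-term $T$ is an $\underline{S}$-storage operator iff for every $n\ge 0$ there is a finite sequence of head reductions $U_i\succ V_i$ ($1\le i\le r$) such that: (1) all $U_i,V_i$ are $\lambda X$-terms; (2) $U_1=(T)X_n f$ and $V_r=(f)\tau_n$ with $\tau_n$ a closed $\lambda$-term $\beta$-equivalent to $\underline{n}$;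 (3) for $i<r$, $V_i=(X_n)ab\overline{c}$ or $V_i=(X_{l,a,b,\overline{c}})uv\overline{w}$ with $0\le l\le n-1$; (4) if $V_i=(X_n)ab\overline{c}$ then $U_{i+1}=(\underline{0})ab\overline{c}$ if $n=0$ and $U_{i+1}=((\underline{S})X_{n-1,a,b,\overline{c}})ab\overline{c}$ if $n\ne 0$; (5) if $V_i=(X_{l,a,b,\overline{c}})uv\overline{w}$ then $U_{i+1}=(\underline{0})uv\overline{w}$ if $l=0$ and $U_{i+1}=((\underline{S})X_{l-1,u,v,\overline{w}})uv\overline{w}$ if $l\ne 0$. *)

theory Defs
  imports Main
begin

text \<open>
  Terms are in de Bruijn notation. The labels of a constant \<open>XL l a b cs\<close> serve only to name it:
  they belong to the ambient (top-level) context, so lifting, substitution, free variables and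
  reduction never look inside them. Since the datatype is well-founded, \<open>XL l a b cs\<close> does not
  occur in \<open>a\<close>, \<open>b\<close>, \<open>cs\<close>.
\<close>

datatype xterm =
    Var nat
  | App xterm xterm
  | Lam xterm
  | X nat
  | XL nat xterm xterm "xterm list"

abbreviation apps :: "xterm \<Rightarrow> xterm list \<Rightarrow> xterm" where
  "apps t us \<equiv> foldl App t us"

primrec lambda_term :: "xterm \<Rightarrow> bool" where
  "lambda_term (Var i) = True"
| "lambda_term (App t u) = (lambda_term t \<and> lambda_term u)"
| "lambda_term (Lam t) = lambda_term t"
| "lambda_term (X i) = False"
| "lambda_term (XL l a b cs) = False"

primrec fv :: "xterm \<Rightarrow> nat set" where
  "fv (Var i) = {i}"
| "fv (App t u) = fv t \<union> fv u"
| "fv (Lam t) = {i. Suc i \<in> fv t}"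
| "fv (X i) = {}"
| "fv (XL l a b cs) = {}"

definition closed_lambda_term :: "xterm \<Rightarrow> bool" where
  "closed_lambda_term t \<longleftrightarrow> lambda_term t \<and> fv t = {}"

primrec lift :: "nat \<Rightarrow> xterm \<Rightarrow> xterm" where
  "lift k (Var i) = (if i < k then Var i else Var (Suc i))"
| "lift k (App t u) = App (lift k t) (lift k u)"
| "lift k (Lam t) = Lam (lift (Suc k) t)"
| "lift k (X i) = X i"
| "lift k (XL l a b cs) = XL l a b cs"

text \<open>\<open>subst k s t\<close> replaces index \<open>k\<close> by \<open>s\<close> in \<open>t\<close> and decrements the indices above \<open>k\<close>.\<close>

primrec subst :: "nat \<Rightarrow> xterm \<Rightarrow> xterm \<Rightarrow> xterm" where
  "subst k s (Var i) = (if i < k then Var i else if i = k then s else Var (i - 1))"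
| "subst k s (App t u) = App (subst k s t) (subst k s u)"
| "subst k s (Lam t) = Lam (subst (Suc k) (lift 0 s) t)"
| "subst k s (X i) = X i"
| "subst k s (XL l a b cs) = XL l a b cs"

inductive beta :: "xterm \<Rightarrow> xterm \<Rightarrow> bool" where
  "beta (App (Lam t) u) (subst 0 u t)"
| "beta t t' \<Longrightarrow> beta (App t u) (App t' u)"
| "beta u u' \<Longrightarrow> beta (App t u) (App t u')"
| "beta t t' \<Longrightarrow> beta (Lam t) (Lam t')"

text \<open>
  \<open>\<beta>\<close>-equivalence is only used between \<open>\<lambda>\<close>-terms; all intermediate terms of a conversion are
  required to be \<open>\<lambda>\<close>-terms as well.
\<close>

definition beta_eq :: "xterm \<Rightarrow> xterm \<Rightarrow> bool"  (infix \<open>\<simeq>\<close> 50) where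
  "beta_eq = equivclp (\<lambda>t u. lambda_term t \<and> lambda_term u \<and> beta t u)"

inductive head_step :: "xterm \<Rightarrow> xterm \<Rightarrow> bool" where
  "head_step ((Lam ^^ m) (apps (App (Lam t) u) us)) ((Lam ^^ m) (apps (subst 0 u t) us))"

abbreviation head_red :: "xterm \<Rightarrow> xterm \<Rightarrow> bool"  (infix \<open>\<succ>\<close> 50) where
  "head_red \<equiv> head_step\<^sup>*\<^sup>*"

definition church :: "nat \<Rightarrow> xterm" where
  "church n = Lam (Lam ((App (Var 1) ^^ n) (Var 0)))"

definition successor :: "xterm \<Rightarrow> bool" where
  "successor S \<longleftrightarrow> closed_lambda_term S \<and> (\<forall>k. App S (church k) \<simeq> church (Suc k))"

definition storage_operator :: "xterm \<Rightarrow> bool" where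
  "storage_operator T \<longleftrightarrow> closed_lambda_term T \<and>
     (\<forall>n. \<exists>\<tau>. closed_lambda_term \<tau> \<and> \<tau> \<simeq> church n \<and>
        (\<forall>\<theta> f. lambda_term \<theta> \<and> \<theta> \<simeq> church n \<and> f \<notin> fv \<theta> \<longrightarrow>
           App (App T \<theta>) (Var f) \<succ> App (Var f) \<tau>))"

text \<open>
  The sequence of reductions is indexed by \<open>1, \<dots>, r\<close>, values outside this range being irrelevant.
  The bound \<open>0 \<le> l \<le> n - 1\<close> (unsatisfiable for \<open>n = 0\<close>) reads \<open>l < n\<close> on natural numbers.
  Every variable \<open>f\<close> is fresh here, as \<open>T\<close> is closed and \<open>X n\<close> is a constant.
\<close>

definition S_storage_operator :: "xterm \<Rightarrow> xterm \<Rightarrow> bool" where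
  "S_storage_operator S T \<longleftrightarrow> closed_lambda_term T \<and>
     (\<forall>n f. \<exists>(r::nat) (U :: nat \<Rightarrow> xterm) (V :: nat \<Rightarrow> xterm).
        1 \<le> r \<and>
        (\<forall>i\<in>{1..r}. U i \<succ> V i) \<and>
        U 1 = App (App T (X n)) (Var f) \<and>
        (\<exists>\<tau>. V r = App (Var f) \<tau> \<and> closed_lambda_term \<tau> \<and> \<tau> \<simeq> church n) \<and>
        (\<forall>i\<in>{1..<r}.
           (\<exists>a b cs. V i = apps (X n) (a # b # cs)) \<or>
           (\<exists>l a b cs u v ws. l < n \<and> V i = apps (XL l a b cs) (u # v # ws))) \<and>
        (\<forall>i\<in>{1..<r}. \<forall>a b cs. V i = apps (X n) (a # b # cs) \<longrightarrow>
           U (Suc i) =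
             (if n = 0 then apps (church 0) (a # b # cs)
              else apps (App S (XL (n - 1) a b cs)) (a # b # cs))) \<and>
        (\<forall>i\<in>{1..<r}. \<forall>l a b cs u v ws. V i = apps (XL l a b cs) (u # v # ws) \<longrightarrow>
           U (Suc i) =
             (if l = 0 then apps (church 0) (u # v # ws)
              else apps (App S (XL (l - 1) u v ws)) (u # v # ws))))"

end

theory Submission
  imports Defs
begin

text \<open>
  Fix \<open>n\<close>, a successor \<open>S\<close> and the term \<open>\<tau>\<close> which \<open>T\<close> produces for \<open>n\<close>. Put
  \<open>\<theta>\<^sub>l = \<lambda>x y. (M\<^sub>l) x y\<close> with \<open>M\<^sub>0 = (\<lambda>z. 0) \<tau>\<close> and \<open>M\<^sub>l\<^sub>+\<^sub>1 = (S) \<theta>\<^sub>l\<close>, so that \<open>\<theta>\<^sub>l\<close> is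
  \<open>\<beta>\<close>-equivalent to the Church integer \<open>l\<close>. Interpreting the constants of index \<open>l\<close> by \<open>\<theta>\<^sub>l\<close> maps
  the head reductions of the \<open>\<lambda>X\<close>-terms, and the jumps between them, to the terminating head
  reduction of \<open>(T) \<theta>\<^sub>n f\<close> to \<open>(f) \<tau>\<close>. The \<open>\<eta>\<close>-expansion in \<open>\<theta>\<^sub>l\<close> makes every jump cost at least
  one step, and prevents a constant with fewer than two arguments from reaching head position, as
  its image would reduce to an abstraction. Finally, \<open>\<tau>\<close> is a proper subterm of each \<open>\<theta>\<^sub>l\<close>, so, for
  reasons of size, a term whose image is \<open>\<tau>\<close> contains no constant and is \<open>\<tau>\<close> itself.
\<close>

section \<open>Substitution and \<open>\<beta>\<close>-equivalence\<close>

lemma lift_eq_self: "(\<And>i. i \<in> fv t \<Longrightarrow> i < k) \<Longrightarrow> lift k t = t"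
proof (induction t arbitrary: k)
  case (Lam t)
  have "i < Suc k" if "i \<in> fv t" for i
    using that Lam.prems[of "i - 1"] by (cases i) auto
  then show ?case using Lam.IH by simp
qed auto

lemma subst_eq_self: "(\<And>i. i \<in> fv t \<Longrightarrow> i < k) \<Longrightarrow> subst k s t = t"
proof (induction t arbitrary: k s)
  case (Lam t)
  have "i < Suc k" if "i \<in> fv t" for i
    using that Lam.prems[of "i - 1"] by (cases i) auto
  then show ?case using Lam.IH by simp
qed auto

lemma closed_lift [simp]: "fv t = {} \<Longrightarrow> lift k t = t"
  by (rule lift_eq_self) auto

lemma closed_subst [simp]: "fv t = {} \<Longrightarrow> subst k s t = t"
  by (rule subst_eq_self) auto

lemma subst_lift [simp]: "subst k s (lift k t) = t"
  by (induction t arbitrary: k s) auto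

lemma lambda_term_lift [simp]: "lambda_term (lift k t) = lambda_term t"
  by (induction t arbitrary: k) auto

lemma lambda_term_subst: "lambda_term t \<Longrightarrow> lambda_term s \<Longrightarrow> lambda_term (subst k s t)"
  by (induction t arbitrary: k s) auto

lemma lambda_term_beta: "beta t u \<Longrightarrow> lambda_term t \<Longrightarrow> lambda_term u"
  by (induction rule: beta.induct) (auto intro: lambda_term_subst)

lemma beta_eq_trans [trans]: "t \<simeq> u \<Longrightarrow> u \<simeq> v \<Longrightarrow> t \<simeq> v"
  unfolding beta_eq_def by (rule equivclp_trans)

lemma beta_imp_beta_eq: "lambda_term t \<Longrightarrow> beta t u \<Longrightarrow> t \<simeq> u"
  unfolding beta_eq_def using lambda_term_beta by (intro r_into_equivclp) auto

lemma beta_eq_compatible: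
  assumes "t \<simeq> u"
    and "\<And>t u. beta t u \<Longrightarrow> beta (C t) (C u)"
    and "\<And>t. lambda_term t \<Longrightarrow> lambda_term (C t)"
  shows "C t \<simeq> C u"
  using assms(1) unfolding beta_eq_def
proof (induction rule: equivclp_induct)
  case (step y z)
  then have "equivclp (\<lambda>t u. lambda_term t \<and> lambda_term u \<and> beta t u) (C y) (C z)"
    using assms(2,3) by (blast intro: r_into_equivclp equivclp_sym)
  with step.IH show ?case by (rule equivclp_trans)
qed simp

lemma beta_eq_App_right: "u \<simeq> u' \<Longrightarrow> lambda_term t \<Longrightarrow> App t u \<simeq> App t u'"
  by (rule beta_eq_compatible) (auto intro: beta.intros)

text \<open>\<open>M\<close> is not lifted under the two binders, so this is a double eta-expansion
  only for closed \<open>M\<close>.\<close>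

definition eta2 :: "xterm \<Rightarrow> xterm" where
  "eta2 M = Lam (Lam (App (App M (Var 1)) (Var 0)))"

lemma lambda_term_eta2 [simp]: "lambda_term (eta2 M) = lambda_term M"
  by (simp add: eta2_def)

lemma closed_eta2: "fv M = {} \<Longrightarrow> fv (eta2 M) = {}"
  by (auto simp: eta2_def)

lemma lambda_term_pow: "lambda_term ((App (Var i) ^^ l) (Var j))"
  by (induction l) auto

lemma fv_pow: "fv ((App (Var i) ^^ l) (Var j)) \<subseteq> {i, j}"
  by (induction l) auto

lemma lambda_term_church [simp]: "lambda_term (church l)"
  by (simp add: church_def lambda_term_pow)

lemma fv_church [simp]: "fv (church l) = {}"
  using fv_pow[of l 1 0] by (force simp: church_def)

text \<open>No eta-rule is involved: \<open>church l\<close> begins with two abstractions, which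
  absorb \<open>Var 1\<close> and \<open>Var 0\<close> in two contractions.\<close>

lemma eta2_church: "eta2 (church l) \<simeq> church l"
proof -
  have s1: "subst (Suc 0) (Var 2) ((App (Var 1) ^^ l) (Var 0)) = (App (Var 2) ^^ l) (Var 0)"
    by (induction l) auto
  have s2: "subst 0 (Var 0) ((App (Var 2) ^^ l) (Var 0)) = (App (Var 1) ^^ l) (Var 0)"
    by (induction l) auto
  have "beta (App (church l) (Var 1)) (Lam ((App (Var 2) ^^ l) (Var 0)))"
    using beta.intros(1)[of "Lam ((App (Var 1) ^^ l) (Var 0))" "Var 1"] s1
    by (simp add: church_def numeral_2_eq_2)
  then have "beta (eta2 (church l)) (Lam (Lam (App (Lam ((App (Var 2) ^^ l) (Var 0))) (Var 0))))"
    unfolding eta2_def by (intro beta.intros)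
  moreover have "beta (App (Lam ((App (Var 2) ^^ l) (Var 0))) (Var 0)) ((App (Var 1) ^^ l) (Var 0))"
    using beta.intros(1)[of "(App (Var 2) ^^ l) (Var 0)" "Var 0"] unfolding s2 .
  then have "beta (Lam (Lam (App (Lam ((App (Var 2) ^^ l) (Var 0))) (Var 0)))) (church l)"
    unfolding church_def by (intro beta.intros)
  ultimately show ?thesis
    by (meson beta_eq_trans beta_imp_beta_eq lambda_term_beta lambda_term_church lambda_term_eta2)
qed

lemma eta2_beta_eq_church: "M \<simeq> church l \<Longrightarrow> eta2 M \<simeq> church l"
  by (rule beta_eq_trans[OF _ eta2_church], rule beta_eq_compatible)
    (auto simp: eta2_def intro: beta.intros)


section \<open>Head reduction\<close>

primrec head :: "xterm \<Rightarrow> xterm" where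
  "head (Var i) = Var i"
| "head (App t u) = head t"
| "head (Lam t) = Lam t"
| "head (X i) = X i"
| "head (XL l a b cs) = XL l a b cs"

primrec args :: "xterm \<Rightarrow> xterm list" where
  "args (Var i) = []"
| "args (App t u) = args t @ [u]"
| "args (Lam t) = []"
| "args (X i) = []"
| "args (XL l a b cs) = []"

lemma head_apps [simp]: "head (apps t us) = head t"
  by (induction us rule: rev_induct) auto

lemma args_apps [simp]: "args (apps t us) = args t @ us"
  by (induction us rule: rev_induct) auto

lemma apps_head_args: "apps (head t) (args t) = t"
  by (induction t) auto

lemma head_neq_App: "head t \<noteq> App u v"
  by (induction t) auto

lemma head_step_redex: "head_step (apps (Lam t) (u # us)) (apps (subst 0 u t) us)"
  using head_step.intros[of 0 t u us] by simp

text \<open>A term with arguments is not an abstraction, which forces \<open>m = 0\<close> in the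
  rule for \<open>head_step\<close>.\<close>

lemma head_step_argsD:
  assumes "head_step s s'" and "args s \<noteq> []"
  shows "\<exists>t u us. head s = Lam t \<and> args s = u # us \<and> s' = apps (subst 0 u t) us"
  using assms
proof cases
  case (1 m t u us)
  with assms(2) have "m = 0" by (cases m) auto
  with 1 show ?thesis by auto
qed

lemma head_step_redexD:
  "head_step (apps (Lam t) (u # us)) s \<Longrightarrow> s = apps (subst 0 u t) us"
  using head_step_argsD[of "apps (Lam t) (u # us)" s] by (simp del: foldl_Cons)

lemma head_step_Lam:
  assumes "head_step (Lam t) s"
  shows "\<exists>t'. s = Lam t'"
  using assms
proof cases
  case (1 m t' u us)
  have "args (Lam t) \<noteq> args (apps (App (Lam t') u) us)" by simp
  with 1 show ?thesis by (cases m) auto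
qed

lemma head_steps_Lam: "(head_step ^^ k) (Lam t) s \<Longrightarrow> \<exists>t'. s = Lam t'"
  by (induction k arbitrary: s) (use head_step_Lam in fastforce)+

lemma no_head_step_Var: "\<not> head_step (apps (Var i) us) s"
proof
  assume *: "head_step (apps (Var i) us) s"
  show False
  proof (cases "us = []")
    case True
    have "Var i \<noteq> (Lam ^^ m) (apps (App (Lam t) u) vs)" for m t u vs
    proof (cases m)
      case 0
      then show ?thesis using args.simps(1)[of i] args_apps[of "App (Lam t) u" vs] by force
    qed auto
    with * True show ?thesis by (metis foldl_Nil head_step.cases)
  next
    case False
    with head_step_argsD[OF *] show ?thesis by simp
  qed
qed

text \<open>The target has a variable as head, so at least one step is made, and it can only
  contract the displayed redex.\<close>

lemma head_steps_redexD:
  assumes "(head_step ^^ k) (apps (Lam t) (u # us)) (App (Var f) v)"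
  shows "\<exists>j. k = Suc j \<and> (head_step ^^ j) (apps (subst 0 u t) us) (App (Var f) v)"
proof (cases k)
  case 0
  have "head (apps (Lam t) (u # us)) \<noteq> head (App (Var f) v)"
    unfolding head_apps by simp
  with 0 assms show ?thesis by (metis relpowp_0_E)
next
  case (Suc j)
  with assms show ?thesis using head_step_redexD relpowp_Suc_D2 by metis
qed

text \<open>With fewer than two arguments the term would be an abstraction after at most one step
  and stay one. With two, contracting both binders leaves the closed \<open>M\<close>
  intact.\<close>

lemma head_steps_eta2D:
  assumes "(head_step ^^ k) (apps (eta2 M) us) (App (Var f) v)" and "fv M = {}"
  shows "\<exists>a b cs j. us = a # b # cs \<and> j < k \<and> (head_step ^^ j) (apps M us) (App (Var f) v)"
proof -
  obtain a bs where us: "us = a # bs"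
    using assms(1) head_steps_Lam unfolding eta2_def by (cases us) auto
  obtain j where j: "k = Suc j"
    "(head_step ^^ j) (apps (Lam (App (App M (lift 0 a)) (Var 0))) bs) (App (Var f) v)"
    using head_steps_redexD[of k "Lam (App (App M (Var 1)) (Var 0))" a bs f v] assms
    unfolding eta2_def us by auto
  obtain b cs where bs: "bs = b # cs"
    using j(2) head_steps_Lam by (cases bs) auto
  show ?thesis
    using head_steps_redexD[OF j(2)[unfolded bs]] assms(2) us bs j(1)
    by (auto intro: less_SucI)
qed


section \<open>Interpreting the constants\<close>

text \<open>Constants are read by index alone, without their labels. Nothing is lifted under
  \<open>Lam\<close>, since closed terms are going to be inserted.\<close>

primrec interp :: "(nat \<Rightarrow> xterm) \<Rightarrow> xterm \<Rightarrow> xterm" where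
  "interp \<theta> (Var i) = Var i"
| "interp \<theta> (App t u) = App (interp \<theta> t) (interp \<theta> u)"
| "interp \<theta> (Lam t) = Lam (interp \<theta> t)"
| "interp \<theta> (X i) = \<theta> i"
| "interp \<theta> (XL l a b cs) = \<theta> l"

lemma interp_apps [simp]: "interp \<theta> (apps t us) = apps (interp \<theta> t) (map (interp \<theta>) us)"
  by (induction us arbitrary: t) auto

lemma interp_lambda_term [simp]: "lambda_term t \<Longrightarrow> interp \<theta> t = t"
  by (induction t) auto

lemma interp_lift: "(\<And>l. fv (\<theta> l) = {}) \<Longrightarrow> interp \<theta> (lift k t) = lift k (interp \<theta> t)"
  by (induction t arbitrary: k) auto

lemma interp_subst:
  "(\<And>l. fv (\<theta> l) = {}) \<Longrightarrow> interp \<theta> (subst k s t) = subst k (interp \<theta> s) (interp \<theta> t)"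
  by (induction t arbitrary: k s) (auto simp: interp_lift)

text \<open>A term that is not a \<lambda>-term contains some constant, whose image is a subterm of
  the whole image.\<close>

lemma size_interp:
  assumes "\<And>l. size v < size (\<theta> l)" and "\<not> lambda_term t"
  shows "size v < size (interp \<theta> t)"
  using assms(2) by (induction t) (auto simp: assms(1) less_SucI trans_less_add1 trans_less_add2)

text \<open>The constants that can arise from \<open>X n\<close>. Head steps and jumps preserve
  this, and it supplies the bound \<open>l < n\<close> demanded of a jump.\<close>

primrec consts_ok :: "nat \<Rightarrow> xterm \<Rightarrow> bool" where
  "consts_ok n (Var i) = True"
| "consts_ok n (App t u) = (consts_ok n t \<and> consts_ok n u)"
| "consts_ok n (Lam t) = consts_ok n t"
| "consts_ok n (X i) = (i = n)"
| "consts_ok n (XL l a b cs) = (l < n)"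

lemma consts_ok_lambda_term: "lambda_term t \<Longrightarrow> consts_ok n t"
  by (induction t) auto

lemma consts_ok_apps [simp]:
  "consts_ok n (apps t us) \<longleftrightarrow> consts_ok n t \<and> (\<forall>u\<in>set us. consts_ok n u)"
  by (induction us arbitrary: t) auto

lemma consts_ok_lift [simp]: "consts_ok n (lift k t) = consts_ok n t"
  by (induction t arbitrary: k) auto

lemma consts_ok_subst: "consts_ok n t \<Longrightarrow> consts_ok n s \<Longrightarrow> consts_ok n (subst k s t)"
  by (induction t arbitrary: k s) auto


text \<open>The terms \<open>M\<^sub>l\<close>, with \<open>v\<close> for \<open>\<tau>\<close>. The
  vacuous redex at 0 lets \<open>v\<close> occur without affecting the value; it contracts to
  \<open>church 0\<close>, which a jump at index 0 puts in head position.\<close>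

primrec unroll :: "xterm \<Rightarrow> xterm \<Rightarrow> nat \<Rightarrow> xterm" where
  "unroll S v 0 = App (Lam (church 0)) v"
| "unroll S v (Suc l) = App S (eta2 (unroll S v l))"

lemma closed_unroll:
  assumes "closed_lambda_term S" and "closed_lambda_term v"
  shows "closed_lambda_term (unroll S v l)"
  using assms closed_eta2 by (induction l) (auto simp: closed_lambda_term_def)

lemma unroll_beta_eq_church:
  assumes "successor S" and "closed_lambda_term v"
  shows "unroll S v l \<simeq> church l"
proof (induction l)
  case 0
  show ?case
    using beta.intros(1)[of "church 0" v] assms(2)
    by (auto intro: beta_imp_beta_eq simp: closed_lambda_term_def)
next
  case (Suc l)
  then show ?case
    using assms(1) beta_eq_trans[OF beta_eq_App_right[OF eta2_beta_eq_church]]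
    by (auto simp: successor_def closed_lambda_term_def)
qed

lemma size_unroll: "size v < size (eta2 (unroll S v l))"
  by (induction l) (auto simp: eta2_def)


section \<open>Chains of head reductions\<close>

definition jump_head :: "xterm \<Rightarrow> nat \<Rightarrow> xterm \<Rightarrow> xterm \<Rightarrow> xterm list \<Rightarrow> xterm" where
  "jump_head S l a b cs = (if l = 0 then church 0 else App S (XL (l - 1) a b cs))"

text \<open>The passage from \<open>V i\<close> to \<open>U (Suc i)\<close>. A new constant is
  labelled by the current arguments, not by the labels of the constant it replaces.\<close>

inductive jump :: "xterm \<Rightarrow> nat \<Rightarrow> xterm \<Rightarrow> xterm \<Rightarrow> bool" for S n where
  jump_X: "jump S n (apps (X n) (a # b # cs)) (apps (jump_head S n a b cs) (a # b # cs))"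
| jump_XL: "l < n \<Longrightarrow>
    jump S n (apps (XL l a b cs) (u # v # ws)) (apps (jump_head S l u v ws) (u # v # ws))"

inductive chain :: "xterm \<Rightarrow> nat \<Rightarrow> xterm \<Rightarrow> xterm \<Rightarrow> bool" for S n w where
  chain_last: "t \<succ> w \<Longrightarrow> chain S n w t"
| chain_jump: "t \<succ> t' \<Longrightarrow> jump S n t' u \<Longrightarrow> chain S n w u \<Longrightarrow> chain S n w t"

lemma chain_head_step: "head_step t t' \<Longrightarrow> chain S n w t' \<Longrightarrow> chain S n w t"
  by (erule chain.cases) (auto intro: chain.intros converse_rtranclp_into_rtranclp)

lemma chain_sequences:
  assumes "chain S n w t"
  shows "\<exists>r U V. 1 \<le> r \<and> (\<forall>i\<in>{1..r}. U i \<succ> V i) \<and> U 1 = t \<and> V r = w \<and>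
    (\<forall>i\<in>{1..<r}. jump S n (V i) (U (Suc i)))"
  using assms
proof induction
  case (chain_last t)
  then show ?case
    by - (rule exI[of _ 1], rule exI[of _ "\<lambda>_. t"], rule exI[of _ "\<lambda>_. w"], auto)
next
  case (chain_jump t t' u)
  then obtain r :: nat and U V where r: "1 \<le> r" and
    UV: "\<forall>i\<in>{1..r}. U i \<succ> V i" "U 1 = u" "V r = w" "\<forall>i\<in>{1..<r}. jump S n (V i) (U (Suc i))"
    by blast
  \<comment> \<open>The new segment receives index 1 and the old ones move up by one.\<close>
  define U' where "U' i = (if i = 1 then t else U (i - 1))" for i
  define V' where "V' i = (if i = 1 then t' else V (i - 1))" for i
  have "U' i \<succ> V' i" if "i \<in> {1..Suc r}" for i
  proof (cases "i = 1")
    case False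
    then have "i - 1 \<in> {1..r}" using that by auto
    then show ?thesis using UV(1) False by (simp add: U'_def V'_def)
  qed (simp add: U'_def V'_def chain_jump.hyps(1))
  moreover have "jump S n (V' i) (U' (Suc i))" if "i \<in> {1..<Suc r}" for i
  proof (cases "i = 1")
    case True
    then show ?thesis using chain_jump.hyps(2) UV(2) by (simp add: U'_def V'_def)
  next
    case False
    with that obtain m where "i = Suc m" and "m \<in> {1..<r}" by (cases i) auto
    then show ?thesis using UV(4) by (auto simp: U'_def V'_def)
  qed
  ultimately show ?case
    using r UV(3)
    by - (rule exI[of _ "Suc r"], rule exI[of _ U'], rule exI[of _ V'], auto simp: U'_def V'_def)
qed

text \<open>\<open>head\<close> and \<open>args\<close> make such a decomposition unique, so the
  result of a jump is determined for every way of writing \<open>V i\<close>, as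
  \<open>S_storage_operator\<close> demands.\<close>

lemma jump_XD:
  assumes "jump S n (apps (X m) (a # b # cs)) u"
  shows "u = apps (jump_head S m a b cs) (a # b # cs)"
proof -
  define t where "t = apps (X m) (a # b # cs)"
  then have "head t = X m" "args t = a # b # cs"
    by (simp_all del: foldl_Cons)
  with assms show ?thesis
    unfolding t_def[symmetric] by cases (auto simp del: foldl_Cons)
qed

lemma jump_XLD:
  assumes "jump S n (apps (XL l a' b' cs') (a # b # cs)) u"
  shows "u = apps (jump_head S l a b cs) (a # b # cs)"
proof -
  define t where "t = apps (XL l a' b' cs') (a # b # cs)"
  then have "head t = XL l a' b' cs'" "args t = a # b # cs"
    by (simp_all del: foldl_Cons)
  with assms show ?thesis
    unfolding t_def[symmetric] by cases (auto simp del: foldl_Cons)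
qed

lemma jumpD:
  "jump S n t u \<Longrightarrow> (\<exists>a b cs. t = apps (X n) (a # b # cs)) \<or>
    (\<exists>l a b cs u v ws. l < n \<and> t = apps (XL l a b cs) (u # v # ws))"
  by (erule jump.cases) blast+

lemma S_storage_operatorI:
  assumes "closed_lambda_term T"
    and "\<And>n f. \<exists>\<tau>. closed_lambda_term \<tau> \<and> \<tau> \<simeq> church n \<and>
      chain S n (App (Var f) \<tau>) (App (App T (X n)) (Var f))"
  shows "S_storage_operator S T"
  unfolding S_storage_operator_def
proof (intro conjI allI assms(1), goal_cases)
  case (1 n f)
  obtain \<tau> where \<tau>: "closed_lambda_term \<tau>" "\<tau> \<simeq> church n"
    and "chain S n (App (Var f) \<tau>) (App (App T (X n)) (Var f))"
    using assms(2) by blast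
  from chain_sequences[OF this(3)] obtain r :: nat and U V where r: "1 \<le> r"
    "\<forall>i\<in>{1..r}. U i \<succ> V i" "U 1 = App (App T (X n)) (Var f)" "V r = App (Var f) \<tau>"
    and jump: "\<forall>i\<in>{1..<r}. jump S n (V i) (U (Suc i))"
    by blast
  have "\<forall>i\<in>{1..<r}. (\<exists>a b cs. V i = apps (X n) (a # b # cs)) \<or>
      (\<exists>l a b cs u v ws. l < n \<and> V i = apps (XL l a b cs) (u # v # ws))"
    using jumpD[OF bspec[OF jump]] by (rule ballI)
  moreover have "\<forall>i\<in>{1..<r}. \<forall>a b cs. V i = apps (X n) (a # b # cs) \<longrightarrow>
      U (Suc i) = (if n = 0 then apps (church 0) (a # b # cs)
        else apps (App S (XL (n - 1) a b cs)) (a # b # cs))"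
  proof (intro ballI allI impI)
    fix i a b cs
    assume "i \<in> {1..<r}" "V i = apps (X n) (a # b # cs)"
    then have "jump S n (apps (X n) (a # b # cs)) (U (Suc i))"
      using jump by metis
    from jump_XD[OF this] show "U (Suc i) = (if n = 0 then apps (church 0) (a # b # cs)
        else apps (App S (XL (n - 1) a b cs)) (a # b # cs))"
      by (simp add: jump_head_def)
  qed
  moreover have "\<forall>i\<in>{1..<r}. \<forall>l a b cs u v ws. V i = apps (XL l a b cs) (u # v # ws) \<longrightarrow>
      U (Suc i) = (if l = 0 then apps (church 0) (u # v # ws)
        else apps (App S (XL (l - 1) u v ws)) (u # v # ws))"
  proof (intro ballI allI impI)
    fix i l a b cs u v ws
    assume "i \<in> {1..<r}" "V i = apps (XL l a b cs) (u # v # ws)"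
    then have "jump S n (apps (XL l a b cs) (u # v # ws)) (U (Suc i))"
      using jump by metis
    from jump_XLD[OF this] show "U (Suc i) = (if l = 0 then apps (church 0) (u # v # ws)
        else apps (App S (XL (l - 1) u v ws)) (u # v # ws))"
      by (simp add: jump_head_def)
  qed
  moreover have "\<exists>\<tau>. V r = App (Var f) \<tau> \<and> closed_lambda_term \<tau> \<and> \<tau> \<simeq> church n"
    using r(4) \<tau> by blast
  ultimately show ?case
    using r(1-3) by - (rule exI[of _ r], rule exI[of _ U], rule exI[of _ V], intro conjI)
qed

text \<open>Strong induction on \<open>k\<close>: a head step or jump of \<open>t\<close> is matched
  by at least one step of its image, so the reduction left for the image gets shorter.\<close>

lemma chain_if_interp_reduces:
  assumes S: "closed_lambda_term S" and \<tau>: "closed_lambda_term \<tau>"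
    and "(head_step ^^ k) (interp (\<lambda>l. eta2 (unroll S \<tau> l)) t) (App (Var f) \<tau>)"
    and "consts_ok n t"
  shows "chain S n (App (Var f) \<tau>) t"
  using assms(3,4)
proof (induction k arbitrary: t rule: less_induct)
  case (less k)
  let ?w = "App (Var f) \<tau>" and ?\<theta> = "\<lambda>l. eta2 (unroll S \<tau> l)"
  have closed_\<theta>: "fv (?\<theta> l) = {}" for l
    using closed_unroll[OF S \<tau>, of l] by (simp add: closed_lambda_term_def closed_eta2)
  obtain us where t: "t = apps (head t) us" and us: "us = args t"
    by (metis apps_head_args)
  have ok: "consts_ok n (head t)" "\<forall>u\<in>set us. consts_ok n u"
    using less.prems(2) t by (metis consts_ok_apps)+
  have red: "(head_step ^^ k) (apps (interp ?\<theta> (head t)) (map (interp ?\<theta>) us)) ?w"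
    using less.prems(1) t by (metis interp_apps)
  \<comment> \<open>Both kinds of constants are treated at once, as their images depend only on
    \<open>l\<close>. The two arguments absorbed by \<open>eta2\<close> are those required for a
    jump.\<close>
  have const: "\<exists>a b cs. us = a # b # cs \<and> chain S n ?w (apps (jump_head S l a b cs) us)"
    if l: "interp ?\<theta> (head t) = ?\<theta> l" "l \<le> n" for l
  proof -
    obtain a b cs j where abc: "us = a # b # cs" and j: "j < k"
      "(head_step ^^ j) (apps (unroll S \<tau> l) (map (interp ?\<theta>) us)) ?w"
      using head_steps_eta2D[OF red[unfolded l(1)]] closed_unroll[OF S \<tau>]
      by (auto simp: closed_lambda_term_def map_eq_Cons_conv)
    have "consts_ok n (apps (jump_head S l a b cs) us)"
      using ok(2) l(2) S
      by (auto simp: jump_head_def closed_lambda_term_def consts_ok_lambda_term)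
    \<comment> \<open>At \<open>l = 0\<close> contracting the vacuous redex takes one further step;
      at \<open>Suc m\<close> the image of \<open>S\<close> applied to the new constant is literally
      \<open>unroll S \<tau> (Suc m)\<close>.\<close>
    moreover have "\<exists>i<k. (head_step ^^ i) (interp ?\<theta> (apps (jump_head S l a b cs) us)) ?w"
    proof (cases l)
      case 0
      then obtain i where "j = Suc i" "(head_step ^^ i) (apps (church 0) (map (interp ?\<theta>) us)) ?w"
        using j(2) head_steps_redexD[of j "church 0" \<tau> "map (interp ?\<theta>) us" f \<tau>] by auto
      then show ?thesis using j(1) 0 by (auto simp: jump_head_def intro: exI[of _ i])
    next
      case (Suc m)
      then show ?thesis
        using j S by (auto simp: jump_head_def closed_lambda_term_def)
    qed
    ultimately show ?thesis using less.IH abc by blast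
  qed
  show ?case
  proof (cases "head t")
    case (Var i)
    have "k = 0"
      using red Var no_head_step_Var by (metis interp.simps(1) not0_implies_Suc relpowp_Suc_D2)
    then have eq: "apps (Var i) (map (interp ?\<theta>) us) = ?w"
      using red Var by simp
    \<comment> \<open>Comparing heads and arguments shows that \<open>t\<close> is
      \<open>(f) u\<close>, where \<open>u\<close> has image \<open>\<tau>\<close>. By size,
      \<open>u\<close> contains no constant, so it is its own image.\<close>
    from arg_cong[OF eq, of head] arg_cong[OF eq, of args]
    obtain u where u: "i = f" "us = [u]" "interp ?\<theta> u = \<tau>" by auto
    then have "lambda_term u"
      using size_interp[of \<tau> ?\<theta> u] size_unroll by auto
    with u t Var have "t = ?w" by simp
    then show ?thesis by (auto intro: chain_last)
  next
    case (App u v)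
    then show ?thesis by (simp add: head_neq_App)
  next
    case (Lam s)
    then obtain u vs where uvs: "us = u # vs"
      using red head_steps_Lam by (cases us) auto
    have "(head_step ^^ k) (apps (Lam (interp ?\<theta> s)) (interp ?\<theta> u # map (interp ?\<theta>) vs)) ?w"
      using red unfolding Lam uvs by simp
    from head_steps_redexD[OF this] obtain j where "k = Suc j"
      "(head_step ^^ j) (apps (subst 0 (interp ?\<theta> u) (interp ?\<theta> s)) (map (interp ?\<theta>) vs)) ?w"
      by blast
    then have "chain S n ?w (apps (subst 0 u s) vs)"
      using less.IH[of j "apps (subst 0 u s) vs"] ok uvs Lam
      by (simp add: interp_subst[of ?\<theta>, OF closed_\<theta>] consts_ok_subst)
    moreover have "head_step t (apps (subst 0 u s) vs)"
      using head_step_redex t Lam uvs by metis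
    ultimately show ?thesis by (rule chain_head_step[rotated])
  next
    case (X m)
    then have "m = n" using ok by simp
    with const[of n] X obtain a b cs
      where "us = a # b # cs" "chain S n ?w (apps (jump_head S n a b cs) us)" by auto
    then show ?thesis
      using t X \<open>m = n\<close> jump_X by (metis chain_jump rtranclp.rtrancl_refl)
  next
    case (XL l a' b' cs')
    then have "l < n" using ok by simp
    with const[of l] XL obtain a b cs
      where "us = a # b # cs" "chain S n ?w (apps (jump_head S l a b cs) us)" by auto
    then show ?thesis
      using t XL \<open>l < n\<close> jump_XL by (metis chain_jump rtranclp.rtrancl_refl)
  qed
qed

theorem theorem1:
  fixes T :: xterm
  assumes "storage_operator T"
  shows "\<forall>S. successor S \<longrightarrow> S_storage_operator S T"
proof (intro allI impI S_storage_operatorI)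
  show T: "closed_lambda_term T"
    using assms by (simp add: storage_operator_def)
  fix S n f
  assume S: "successor S"
  then have S': "closed_lambda_term S" by (simp add: successor_def)
  obtain \<tau> where \<tau>: "closed_lambda_term \<tau>" "\<tau> \<simeq> church n"
    and red: "\<And>\<theta> f. lambda_term \<theta> \<Longrightarrow> \<theta> \<simeq> church n \<Longrightarrow> f \<notin> fv \<theta> \<Longrightarrow>
      App (App T \<theta>) (Var f) \<succ> App (Var f) \<tau>"
    using assms unfolding storage_operator_def by meson
  \<comment> \<open>\<open>\<tau>\<close> is chosen before any \<open>\<theta>\<close> is given; it
    may therefore be built into the very term to which \<open>red\<close> is then applied.\<close>
  let ?\<theta> = "\<lambda>l. eta2 (unroll S \<tau> l)"
  have "lambda_term (?\<theta> n)" "f \<notin> fv (?\<theta> n)"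
    using closed_unroll[OF S' \<tau>(1), of n] closed_eta2 by (auto simp: closed_lambda_term_def)
  moreover have "?\<theta> n \<simeq> church n"
    by (intro eta2_beta_eq_church unroll_beta_eq_church S \<tau>(1))
  ultimately have "App (App T (?\<theta> n)) (Var f) \<succ> App (Var f) \<tau>"
    by (intro red)
  then obtain k where "(head_step ^^ k) (App (App T (?\<theta> n)) (Var f)) (App (Var f) \<tau>)"
    using rtranclp_imp_relpowp by metis
  \<comment> \<open>\<open>interp\<close> fixes the \<lambda>-term \<open>T\<close> and sends
    \<open>X n\<close> to \<open>?\<theta> n\<close>.\<close>
  then have "chain S n (App (Var f) \<tau>) (App (App T (X n)) (Var f))"
    using T by (intro chain_if_interp_reduces[OF S' \<tau>(1)])
      (auto simp: closed_lambda_term_def consts_ok_lambda_term)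
  with \<tau> show "\<exists>\<tau>. closed_lambda_term \<tau> \<and> \<tau> \<simeq> church n \<and>
      chain S n (App (Var f) \<tau>) (App (App T (X n)) (Var f))"
    by blast
qed

end
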